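(* Let $d \ge 1$ be an integer and $\alpha \in (0,2]$. Then the geometric $\alpha$-stable process on $\mathbb{R}^d$ has a transition density with respect to the Lebesgue measure. That is, for every $t>0$ the transition probability measure $p_t(dy)$ on $\mathbb{R}^d$, determined by $\int_{\mathbb{R}^d} e^{i\langle \xi, y\rangle}\, p_t(dy) = (1+|\xi|^{\alpha})^{-t}$ for all $\xi \in \mathbb{R}^d$, is absolutely continuous with respect to the Lebesgue measure on $\mathbb{R}^d$.
   Context: Let $d\ge 1$ and $\alpha \in (0,2]$. The geometric $\alpha$-stable process on $\mathbb{R}^d$ is the Lévy process $(\mathbb{P}_x, X_t)$ with symbol (characteristic exponent) $\psi(\xi) = \log(1+|\xi|^{\alpha})$, i.e. $X_t = x + L_t$ under $\mathbb{P}_x$, where $L$ is a Lévy process started at $0$ with $\mathbb{E}[e^{i\langle \xi, L_t\rangle}] = e^{-t\psi(\xi)} = (1+|\xi|^{\alpha})^{-t}$ for $\xi\in\mathbb{R}^d$, $t\ge 0$. The transition probability measure $p_t(dy)$ is the law of $L_t$, so that $\mathbb{E}_x[f(X_t)] = \int_{\mathbb{R}^d} f(x+y)\,p_t(dy)$ for bounded Borel $f$. *)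

theory Defs
  imports "HOL-Probability.Probability"
begin

text \<open>The library's \<^const>\<open>char\<close> covers measures on the real line only.\<close>

definition char_fun :: "'b::euclidean_space measure \<Rightarrow> 'b \<Rightarrow> complex" where
  "char_fun p \<xi> = (CLINT y|p. iexp (\<xi> \<bullet> y))"

text \<open>Levy processes started at 0. The time parameter ranges over the nonnegative reals; values of
  \<open>L t\<close> for \<open>t < 0\<close> are irrelevant. The last two clauses say that almost all paths are
  right-continuous with left limits.\<close>

definition levy_process :: "'w measure \<Rightarrow> (real \<Rightarrow> 'w \<Rightarrow> 'b::euclidean_space) \<Rightarrow> bool" where
  "levy_process M L \<longleftrightarrow>
     prob_space M \<and>
     (\<forall>t\<ge>0. L t \<in> borel_measurable M) \<and>
     (AE \<omega> in M. L 0 \<omega> = 0) \<and>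
     (\<forall>(n::nat) ts :: nat \<Rightarrow> real. 0 \<le> ts 0 \<longrightarrow> mono ts \<longrightarrow>
        prob_space.indep_vars M (\<lambda>_. borel) (\<lambda>i \<omega>. L (ts (Suc i)) \<omega> - L (ts i) \<omega>) {..<n}) \<and>
     (\<forall>s\<ge>0. \<forall>t\<ge>0. distr M borel (\<lambda>\<omega>. L (s + t) \<omega> - L s \<omega>) = distr M borel (L t)) \<and>
     (AE \<omega> in M. \<forall>t\<ge>0. ((\<lambda>s. L s \<omega>) \<longlongrightarrow> L t \<omega>) (at_right t)) \<and>
     (AE \<omega> in M. \<forall>t>0. \<exists>l. ((\<lambda>s. L s \<omega>) \<longlongrightarrow> l) (at_left t))"

text \<open>The law of \<open>X\<^sub>t = x + L\<^sub>t\<close> under \<open>P\<^sub>x\<close>, i.e. \<open>P\<^sub>x(X\<^sub>t \<in> A)\<close> as a measure in \<open>A\<close>.\<close>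

definition transition_kernel ::
    "'w measure \<Rightarrow> (real \<Rightarrow> 'w \<Rightarrow> 'b::euclidean_space) \<Rightarrow> real \<Rightarrow> 'b \<Rightarrow> 'b measure" where
  "transition_kernel M L t x = distr M borel (\<lambda>\<omega>. x + L t \<omega>)"

definition transition_measure ::
    "'w measure \<Rightarrow> (real \<Rightarrow> 'w \<Rightarrow> 'b::euclidean_space) \<Rightarrow> real \<Rightarrow> 'b measure" where
  "transition_measure M L t = distr M borel (L t)"

definition has_symbol ::
    "'w measure \<Rightarrow> (real \<Rightarrow> 'w \<Rightarrow> 'b::euclidean_space) \<Rightarrow> ('b \<Rightarrow> real) \<Rightarrow> bool" where
  "has_symbol M L \<psi> \<longleftrightarrow>
     (\<forall>t\<ge>0. \<forall>\<xi>. char_fun (transition_measure M L t) \<xi> = of_real (exp (- t * \<psi> \<xi>)))"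

definition geometric_stable_process ::
    "real \<Rightarrow> 'w measure \<Rightarrow> (real \<Rightarrow> 'w \<Rightarrow> 'b::euclidean_space) \<Rightarrow> bool" where
  "geometric_stable_process \<alpha> M L \<longleftrightarrow>
     levy_process M L \<and> has_symbol M L (\<lambda>\<xi>. ln (1 + norm \<xi> powr \<alpha>))"

definition has_transition_density ::
    "'w measure \<Rightarrow> (real \<Rightarrow> 'w \<Rightarrow> 'b::euclidean_space) \<Rightarrow> bool" where
  "has_transition_density M L \<longleftrightarrow>
     (\<exists>\<rho> :: real \<Rightarrow> 'b \<Rightarrow> 'b \<Rightarrow> ennreal. \<forall>t>0.
        (\<lambda>(x, y). \<rho> t x y) \<in> borel_measurable (borel \<Otimes>\<^sub>M borel) \<and>
        (\<forall>x. transition_kernel M L t x = density lborel (\<rho> t x)))"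

end

theory Submission
  imports Defs "HOL-Real_Asymp.Real_Asymp"
begin

text \<open>The function \<open>(1 + \<bar>\<xi>\<bar>\<^sup>\<alpha>) powr (- t)\<close> need not be integrable for small \<open>t\<close>, so Fourier inversion does
  not give a density directly. It is, however, a Gamma mixture of the integrable functions
  \<open>exp (- s \<bar>\<xi>\<bar>\<^sup>\<alpha>)\<close>: the geometric stable process is a stable process run at the times of a Gamma
  subordinator. The Gamma law has no atom at 0. The part of the mixture with \<open>s \<ge> \<delta>\<close> has a bounded
  density, since \<open>exp (- \<delta> \<bar>\<xi>\<bar>\<^sup>\<alpha>)\<close> is integrable, and the part with \<open>s < \<delta>\<close> has small mass. Hence a Lebesgue
  null set has measure at most the Gamma mass of \<open>(0, \<delta>)\<close> for every \<open>\<delta> > 0\<close>, which means measure zero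
  (\<open>absolutely_continuous_exponential_mixture\<close>).

  The mass bound for small \<open>s\<close> needs positivity of the inverse Fourier transform of \<open>exp (- s \<bar>\<xi>\<bar>\<^sup>\<alpha>)\<close>. It
  is extracted from the given law itself: \<open>exp (- s \<bar>\<xi>\<bar>\<^sup>\<alpha>)\<close> is the pointwise limit of the characteristic
  functions of rescaled convolution powers of that law (\<open>exp_neg_norm_powr_limit_of_char_funs\<close>).

  All estimates are made after convolution with a Gaussian: there Fourier inversion is an instance of
  Fubini
  (\<open>smoothing_eq_convolution\<close>), positivity and the mass bound pass to limits (\<open>smoothing_limit\<close>), and the
  resulting estimate on open sets survives removal of the Gaussian (\<open>open_measure_le_liminf_smoothing\<close>).
  Outer regularity of Lebesgue measure then handles null sets.\<close>

section \<open>Gaussian measure on Euclidean space\<close>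

lemma nn_integral_lborel_affine:
  fixes f :: "'b::euclidean_space \<Rightarrow> ennreal"
  assumes [measurable]: "f \<in> borel_measurable borel" and c: "c > 0"
  shows "(\<integral>\<^sup>+x. f x \<partial>lborel) = ennreal (c ^ DIM('b)) * (\<integral>\<^sup>+x. f (t + c *\<^sub>R x) \<partial>lborel)"
proof -
  have "(\<integral>\<^sup>+x. f x \<partial>lborel)
      = (\<integral>\<^sup>+x. f x \<partial>density (distr lborel borel (\<lambda>x. t + c *\<^sub>R x)) (\<lambda>_. ennreal (\<bar>c\<bar> ^ DIM('b))))"
    using lborel_affine[of c t] c by simp
  also have "\<dots> = ennreal (c ^ DIM('b)) * (\<integral>\<^sup>+x. f (t + c *\<^sub>R x) \<partial>lborel)"
    using c by (simp add: nn_integral_density nn_integral_distr nn_integral_cmult)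
  finally show ?thesis .
qed

text \<open>The Bochner counterpart of \<open>nn_integral_lborel_prod\<close>; the complex-valued case reduces the
  Fourier transform of a Gaussian to dimension one.\<close>

lemma integral_lborel_prod:
  fixes f :: "'b::euclidean_space \<Rightarrow> real \<Rightarrow> 'c::{real_normed_field,banach,second_countable_topology}"
  assumes f: "\<And>b. b \<in> Basis \<Longrightarrow> integrable lborel (f b)"
  shows "(\<integral>x. (\<Prod>b\<in>Basis. f b (x \<bullet> b)) \<partial>lborel) = (\<Prod>b\<in>Basis. \<integral>x. f b x \<partial>lborel)"
proof -
  interpret product_sigma_finite "\<lambda>_::'b. lborel :: real measure" ..
  have [measurable]: "\<And>b. b \<in> Basis \<Longrightarrow> f b \<in> borel_measurable borel"
    using f by (auto dest: borel_measurable_integrable)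
  have "(\<integral>x. (\<Prod>b\<in>Basis. f b (x \<bullet> b)) \<partial>lborel)
      = (\<integral>g. (\<Prod>b\<in>Basis. f b (g b)) \<partial>(\<Pi>\<^sub>M b\<in>(Basis::'b set). lborel))"
    by (subst lborel_eq, subst integral_distr) simp_all
  also have "\<dots> = (\<Prod>b\<in>Basis. \<integral>x. f b x \<partial>lborel)"
    using f by (intro product_integral_prod) auto
  finally show ?thesis .
qed

definition gauss :: "'b::euclidean_space \<Rightarrow> real" where
  "gauss x = (\<Prod>b\<in>Basis. std_normal_density (x \<bullet> b))"

definition gauss_measure :: "'b::euclidean_space measure" where
  "gauss_measure = density lborel (\<lambda>x. ennreal (gauss x))"

lemma gauss_measurable [measurable]: "gauss \<in> borel_measurable borel"
  unfolding gauss_def by measurable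

lemma sets_gauss_measure [simp, measurable_cong]: "sets gauss_measure = sets borel"
  by (simp add: gauss_measure_def)

lemma gauss_pos: "0 < gauss x"
  unfolding gauss_def by (intro prod_pos) (auto intro: normal_density_pos)

lemma exp_norm_square_eq_prod:
  fixes x :: "'b::euclidean_space"
  shows "exp (- (norm x)\<^sup>2 / 2) = (\<Prod>b\<in>Basis. exp (- (x \<bullet> b)\<^sup>2 / 2))"
proof -
  have "(norm x)\<^sup>2 = (\<Sum>b\<in>Basis. (x \<bullet> b)\<^sup>2)"
    using euclidean_inner[of x x] by (simp add: dot_square_norm power2_eq_square)
  then have "- (norm x)\<^sup>2 / 2 = (\<Sum>b\<in>Basis. - (x \<bullet> b)\<^sup>2 / 2)"
    by (simp add: sum_negf sum_divide_distrib)
  then show ?thesis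
    by (simp only: exp_sum[OF finite_Basis])
qed

lemma gauss_eq: "gauss (x::'b::euclidean_space) = gauss (0::'b) * exp (- (norm x)\<^sup>2 / 2)"
proof -
  have "gauss x = (\<Prod>b\<in>Basis. std_normal_density ((0::'b) \<bullet> b) * exp (- (x \<bullet> b)\<^sup>2 / 2))"
    unfolding gauss_def std_normal_density_def by (intro prod.cong) simp_all
  also have "\<dots> = gauss (0::'b) * (\<Prod>b\<in>Basis. exp (- (x \<bullet> b)\<^sup>2 / 2))"
    by (simp only: gauss_def prod.distrib)
  finally show ?thesis
    by (simp only: exp_norm_square_eq_prod)
qed

lemma gauss_le: "gauss (x::'b::euclidean_space) \<le> gauss (0::'b)"
  unfolding gauss_eq[of x]
  using mult_left_mono[of "exp (- (norm x)\<^sup>2 / 2)" 1 "gauss (0::'b)"] gauss_pos[of "0::'b"] by simp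

lemma nn_integral_gauss: "(\<integral>\<^sup>+x. ennreal (gauss (x::'b::euclidean_space)) \<partial>lborel) = 1"
proof -
  interpret N: prob_space std_normal_distribution
    by (rule prob_space_normal_density) simp
  have 1: "(\<integral>\<^sup>+x. ennreal (std_normal_density x) \<partial>lborel) = 1"
    using N.emeasure_space_1 by (simp add: emeasure_density)
  have "(\<integral>\<^sup>+x. ennreal (gauss (x::'b)) \<partial>lborel)
      = (\<integral>\<^sup>+x. (\<Prod>b\<in>Basis. ennreal (std_normal_density ((x::'b) \<bullet> b))) \<partial>lborel)"
    unfolding gauss_def by (simp add: prod_ennreal)
  also have "\<dots> = 1"
    by (subst nn_integral_lborel_prod) (simp_all add: 1)
  finally show ?thesis .
qed

lemma prob_space_gauss_measure: "prob_space gauss_measure"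
  by (rule prob_spaceI) (simp add: gauss_measure_def emeasure_density nn_integral_gauss)

lemma char_fun_gauss_measure:
  fixes z :: "'b::euclidean_space"
  shows "char_fun gauss_measure z = of_real (exp (- (norm z)\<^sup>2 / 2))"
proof -
  let ?f = "\<lambda>u x. std_normal_density x *\<^sub>R iexp (u * x)"
  have int: "integrable lborel (?f u)" for u
  proof (rule Bochner_Integration.integrable_bound)
    show "integrable lborel std_normal_density" by simp
  qed (auto simp: norm_mult)
  have val: "(\<integral>x. ?f u x \<partial>lborel) = of_real (exp (- u\<^sup>2 / 2))" for u
    using fun_cong[OF char_std_normal_distribution, of u]
    by (simp add: char_def integral_density)
  have "char_fun gauss_measure z = (\<integral>y. gauss y *\<^sub>R iexp (z \<bullet> y) \<partial>lborel)"
    unfolding char_fun_def gauss_measure_def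
    by (subst integral_density) (auto intro: less_imp_le gauss_pos)
  also have "\<dots> = (\<integral>y. (\<Prod>b\<in>Basis. ?f (z \<bullet> b) (y \<bullet> b)) \<partial>lborel)"
  proof (rule Bochner_Integration.integral_cong[OF refl])
    fix y :: 'b
    have "(\<Prod>b\<in>Basis. iexp ((z \<bullet> b) * (y \<bullet> b))) = exp (\<Sum>b\<in>Basis. \<i> * of_real ((z \<bullet> b) * (y \<bullet> b)))"
      by (simp add: exp_sum)
    also have "(\<Sum>b\<in>Basis. \<i> * complex_of_real ((z \<bullet> b) * (y \<bullet> b))) = \<i> * of_real (z \<bullet> y)"
      by (simp add: euclidean_inner[of z y] sum_distrib_left)
    finally show "gauss y *\<^sub>R iexp (z \<bullet> y) = (\<Prod>b\<in>Basis. ?f (z \<bullet> b) (y \<bullet> b))"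
      by (simp add: gauss_def scaleR_conv_of_real prod.distrib)
  qed
  also have "\<dots> = (\<Prod>b\<in>Basis. of_real (exp (- (z \<bullet> b)\<^sup>2 / 2)))"
    by (subst integral_lborel_prod) (auto simp only: int val)
  finally show ?thesis
    by (simp only: exp_norm_square_eq_prod of_real_prod)
qed

section \<open>Gaussian smoothing of real characteristic functions\<close>

lemma borel_measurable_Re_char_fun:
  fixes p :: "'b::euclidean_space measure"
  assumes "prob_space p" and [simp, measurable_cong]: "sets p = sets borel"
  shows "(\<lambda>\<xi>. Re (char_fun p \<xi>)) \<in> borel_measurable borel"
proof -
  interpret prob_space p by fact
  show ?thesis unfolding char_fun_def by measurable
qed

lemma norm_char_fun_le_1:
  assumes "prob_space p"
  shows "norm (char_fun p \<xi>) \<le> 1"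
proof -
  interpret prob_space p by fact
  have "norm (char_fun p \<xi>) \<le> (\<integral>y. norm (iexp (\<xi> \<bullet> y)) \<partial>p)"
    unfolding char_fun_def by (rule integral_norm_bound)
  then show ?thesis by (simp add: prob_space)
qed

text \<open>For the characteristic function \<open>f\<close> of a law \<open>p\<close>, Fourier inversion makes this the convolution of \<open>p\<close>
  with the unnormalised Gaussian \<open>z \<mapsto> exp (- \<bar>\<sigma> z\<bar>\<^sup>2 / 2)\<close>, which concentrates at the origin as
  \<open>\<sigma> \<rightarrow> \<infinity>\<close>. Defining it from \<open>f\<close> alone makes it linear in \<open>f\<close> and meaningful for functions not yet
  known to be characteristic functions. The cosine suffices because all characteristic functions
  considered are real.\<close>

definition smoothing :: "real \<Rightarrow> ('b::euclidean_space \<Rightarrow> real) \<Rightarrow> 'b \<Rightarrow> real" where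
  "smoothing \<sigma> f x = (\<integral>\<xi>. cos (\<sigma> * (x \<bullet> \<xi>)) * f (\<sigma> *\<^sub>R \<xi>) \<partial>gauss_measure)"

text \<open>A Gaussian is its own Fourier transform, so the factor \<open>exp (- \<bar>\<sigma> (y - x)\<bar>\<^sup>2 / 2)\<close> can be written as
  an integral of \<open>exp (i \<sigma> (y - x) \<bullet> \<xi>)\<close> over Gaussian \<open>\<xi>\<close>; exchanging the integrals leaves the
  characteristic function of \<open>p\<close>.\<close>

lemma smoothing_eq_convolution:
  fixes p :: "'b::euclidean_space measure"
  assumes "prob_space p" and [simp, measurable_cong]: "sets p = sets borel"
    and char: "\<And>\<xi>. char_fun p \<xi> = of_real (f \<xi>)"
  shows "smoothing \<sigma> f x = (\<integral>y. exp (- (norm (\<sigma> *\<^sub>R (y - x)))\<^sup>2 / 2) \<partial>p)"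
proof -
  interpret P: prob_space p by fact
  interpret G: prob_space "gauss_measure :: 'b measure" by (rule prob_space_gauss_measure)
  interpret PG: pair_prob_space p "gauss_measure :: 'b measure" ..
  have "complex_of_real (\<integral>y. exp (- (norm (\<sigma> *\<^sub>R (y - x)))\<^sup>2 / 2) \<partial>p)
      = (\<integral>y. char_fun gauss_measure (\<sigma> *\<^sub>R (y - x)) \<partial>p)"
    by (simp add: char_fun_gauss_measure)
  also have "\<dots> = (\<integral>y. (\<integral>\<xi>. iexp ((\<sigma> *\<^sub>R (y - x)) \<bullet> \<xi>) \<partial>gauss_measure) \<partial>p)"
    by (simp add: char_fun_def)
  also have "\<dots> = (\<integral>\<xi>. (\<integral>y. iexp ((\<sigma> *\<^sub>R (y - x)) \<bullet> \<xi>) \<partial>p) \<partial>gauss_measure)"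
    by (rule PG.Fubini_integral[symmetric], rule PG.P.integrable_const_bound[where B=1]) auto
  also have "\<dots> = (\<integral>\<xi>. iexp (- (\<sigma> * (x \<bullet> \<xi>))) * of_real (f (\<sigma> *\<^sub>R \<xi>)) \<partial>gauss_measure)"
  proof (rule Bochner_Integration.integral_cong[OF refl])
    fix \<xi> :: 'b
    have "(\<integral>y. iexp ((\<sigma> *\<^sub>R (y - x)) \<bullet> \<xi>) \<partial>p)
        = (\<integral>y. iexp (- (\<sigma> * (x \<bullet> \<xi>))) * iexp ((\<sigma> *\<^sub>R \<xi>) \<bullet> y) \<partial>p)"
      by (simp add: inner_diff_left algebra_simps inner_commute flip: exp_add)
    also have "\<dots> = iexp (- (\<sigma> * (x \<bullet> \<xi>))) * char_fun p (\<sigma> *\<^sub>R \<xi>)"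
      by (simp add: char_fun_def)
    finally show "(\<integral>y. iexp ((\<sigma> *\<^sub>R (y - x)) \<bullet> \<xi>) \<partial>p)
        = iexp (- (\<sigma> * (x \<bullet> \<xi>))) * of_real (f (\<sigma> *\<^sub>R \<xi>))"
      by (simp add: char)
  qed
  finally have eq: "complex_of_real (\<integral>y. exp (- (norm (\<sigma> *\<^sub>R (y - x)))\<^sup>2 / 2) \<partial>p) = \<dots>" .
  have f_meas [measurable]: "f \<in> borel_measurable borel"
    using borel_measurable_Re_char_fun[of p] assms(1) by (simp add: char)
  have f_bound: "\<bar>f \<xi>\<bar> \<le> 1" for \<xi>
    using norm_char_fun_le_1[OF assms(1), of \<xi>] by (simp add: char)
  have "integrable gauss_measure (\<lambda>\<xi>. iexp (- (\<sigma> * (x \<bullet> \<xi>))) * of_real (f (\<sigma> *\<^sub>R \<xi>)))"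
    by (rule G.integrable_const_bound[where B=1]) (auto simp: norm_mult f_bound)
  then have "Re (\<integral>\<xi>. iexp (- (\<sigma> * (x \<bullet> \<xi>))) * of_real (f (\<sigma> *\<^sub>R \<xi>)) \<partial>gauss_measure)
      = (\<integral>\<xi>. Re (iexp (- (\<sigma> * (x \<bullet> \<xi>))) * of_real (f (\<sigma> *\<^sub>R \<xi>))) \<partial>gauss_measure)"
    by (rule integral_Re[symmetric])
  also have "\<dots> = smoothing \<sigma> f x"
    unfolding smoothing_def by (simp add: Re_exp)
  finally show ?thesis using arg_cong[OF eq, of Re] by (simp only: Re_complex_of_real)
qed

text \<open>Only real-valued characteristic functions, i.e. those of symmetric laws, are covered.\<close>

definition is_char_fun :: "('b::euclidean_space \<Rightarrow> real) \<Rightarrow> bool" where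
  "is_char_fun f \<longleftrightarrow>
     (\<exists>p. prob_space p \<and> sets p = sets borel \<and> (\<forall>\<xi>. char_fun p \<xi> = of_real (f \<xi>)))"

lemma is_char_fun_measurable:
  assumes "is_char_fun f" shows "f \<in> borel_measurable borel"
  using assms borel_measurable_Re_char_fun by (fastforce simp: is_char_fun_def)

lemma is_char_fun_abs_le_1:
  assumes "is_char_fun f" shows "\<bar>f \<xi>\<bar> \<le> 1"
  using assms norm_char_fun_le_1 by (metis is_char_fun_def norm_of_real)

lemma is_char_fun_1: "is_char_fun (\<lambda>\<xi>::'b::euclidean_space. 1)"
proof -
  have "char_fun (return borel 0) \<xi> = 1" for \<xi> :: 'b
    unfolding char_fun_def by (subst integral_return) auto
  then show ?thesis
    unfolding is_char_fun_def by (intro exI[of _ "return borel 0"]) (simp add: prob_space_return)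
qed

lemma is_char_fun_scale:
  fixes f :: "'b::euclidean_space \<Rightarrow> real"
  assumes "is_char_fun f"
  shows "is_char_fun (\<lambda>\<xi>. f (c *\<^sub>R \<xi>))"
proof -
  obtain p where p: "prob_space p" and [simp, measurable_cong]: "sets p = sets borel"
    and char: "\<And>\<xi>. char_fun p \<xi> = of_real (f \<xi>)"
    using assms by (auto simp: is_char_fun_def)
  have "char_fun (distr p borel (\<lambda>y. c *\<^sub>R y)) \<xi> = char_fun p (c *\<^sub>R \<xi>)" for \<xi>
    unfolding char_fun_def by (subst integral_distr) simp_all
  then show ?thesis
    unfolding is_char_fun_def using p char
    by (intro exI[of _ "distr p borel (\<lambda>y. c *\<^sub>R y)"]) (auto intro: prob_space.prob_space_distr)
qed

text \<open>The product belongs to the sum of two independent vectors.\<close>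

lemma is_char_fun_mult:
  fixes f g :: "'b::euclidean_space \<Rightarrow> real"
  assumes "is_char_fun f" "is_char_fun g"
  shows "is_char_fun (\<lambda>\<xi>. f \<xi> * g \<xi>)"
proof -
  obtain p where p: "prob_space p" and [simp, measurable_cong]: "sets p = sets borel"
    and pf: "\<And>\<xi>. char_fun p \<xi> = of_real (f \<xi>)"
    using assms(1) by (auto simp: is_char_fun_def)
  obtain q where q: "prob_space q" and [simp, measurable_cong]: "sets q = sets borel"
    and qg: "\<And>\<xi>. char_fun q \<xi> = of_real (g \<xi>)"
    using assms(2) by (auto simp: is_char_fun_def)
  interpret p: prob_space p by fact
  interpret q: prob_space q by fact
  interpret pq: pair_prob_space p q ..
  let ?m = "distr (p \<Otimes>\<^sub>M q) borel (\<lambda>(x, y). x + y)"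
  have "char_fun ?m \<xi> = char_fun p \<xi> * char_fun q \<xi>" for \<xi>
  proof -
    have "char_fun ?m \<xi> = (\<integral>z. iexp (\<xi> \<bullet> fst z) * iexp (\<xi> \<bullet> snd z) \<partial>(p \<Otimes>\<^sub>M q))"
      unfolding char_fun_def
      by (subst integral_distr)
        (simp_all add: split_beta inner_add_right distrib_left exp_add)
    also have "\<dots> = (\<integral>x. \<integral>y. iexp (\<xi> \<bullet> x) * iexp (\<xi> \<bullet> y) \<partial>q \<partial>p)"
    proof -
      have "integrable (p \<Otimes>\<^sub>M q) (\<lambda>(x, y). iexp (\<xi> \<bullet> x) * iexp (\<xi> \<bullet> y))"
        by (rule pq.P.integrable_const_bound[where B=1]) (auto simp: norm_mult)
      from pq.integral_fst[OF this] show ?thesis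
        by (simp add: case_prod_unfold)
    qed
    finally show ?thesis by (simp add: char_fun_def)
  qed
  moreover have "prob_space ?m"
    by (rule pq.P.prob_space_distr) measurable
  ultimately show ?thesis
    unfolding is_char_fun_def by (intro exI[of _ ?m]) (simp add: pf qg)
qed

lemma is_char_fun_power:
  "is_char_fun f \<Longrightarrow> is_char_fun (\<lambda>\<xi>. f \<xi> ^ n)"
  by (induction n) (auto intro: is_char_fun_1 is_char_fun_mult)

lemma smoothing_nonneg:
  assumes "is_char_fun f" shows "0 \<le> smoothing \<sigma> f x"
proof -
  obtain p where p: "prob_space p" "sets p = sets borel" "\<And>\<xi>. char_fun p \<xi> = of_real (f \<xi>)"
    using assms by (auto simp: is_char_fun_def)
  show ?thesis by (simp add: smoothing_eq_convolution[OF p])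
qed

lemma smoothing_measurable [measurable]:
  fixes f :: "'b::euclidean_space \<Rightarrow> real"
  assumes [measurable]: "f \<in> borel_measurable borel"
  shows "smoothing \<sigma> f \<in> borel_measurable borel"
proof -
  interpret G: prob_space "gauss_measure :: 'b measure" by (rule prob_space_gauss_measure)
  show ?thesis unfolding smoothing_def[abs_def] by measurable
qed

text \<open>Tonelli and the substitution \<open>x = y + z / \<sigma>\<close> move the dependence on \<open>\<sigma>\<close> from the Gaussian into the set.
  The factor \<open>\<sigma> ^ d\<close> is the Jacobian; with it, the total mass does not depend on \<open>\<sigma>\<close>.\<close>

lemma nn_integral_smoothing:
  fixes p :: "'b::euclidean_space measure"
  assumes p: "prob_space p" and sets [simp, measurable_cong]: "sets p = sets borel"
    and char: "\<And>\<xi>. char_fun p \<xi> = of_real (f \<xi>)"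
    and \<sigma>: "\<sigma> > 0" and [measurable]: "A \<in> sets borel"
  shows "ennreal (\<sigma> ^ DIM('b)) * (\<integral>\<^sup>+x. ennreal (smoothing \<sigma> f x) * indicator A x \<partial>lborel)
       = (\<integral>\<^sup>+y. \<integral>\<^sup>+z. indicator A (y + (1 / \<sigma>) *\<^sub>R z) * ennreal (exp (- (norm z)\<^sup>2 / 2)) \<partial>lborel \<partial>p)"
proof -
  interpret p: prob_space p by fact
  interpret pair_sigma_finite p "lborel :: 'b measure" ..
  have sm: "ennreal (smoothing \<sigma> f x) = (\<integral>\<^sup>+y. ennreal (exp (- (norm (\<sigma> *\<^sub>R (y - x)))\<^sup>2 / 2)) \<partial>p)" for x
    unfolding smoothing_eq_convolution[OF p sets char]
    by (rule nn_integral_eq_integral[symmetric], rule p.integrable_const_bound[where B=1]) auto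
  have "(\<integral>\<^sup>+x. ennreal (smoothing \<sigma> f x) * indicator A x \<partial>lborel)
      = (\<integral>\<^sup>+x. \<integral>\<^sup>+y. ennreal (exp (- (norm (\<sigma> *\<^sub>R (y - x)))\<^sup>2 / 2)) * indicator A x \<partial>p \<partial>lborel)"
    by (simp add: sm nn_integral_multc)
  also have "\<dots> = (\<integral>\<^sup>+y. \<integral>\<^sup>+x. ennreal (exp (- (norm (\<sigma> *\<^sub>R (y - x)))\<^sup>2 / 2)) * indicator A x \<partial>lborel \<partial>p)"
    by (rule Fubini') measurable
  finally have "ennreal (\<sigma> ^ DIM('b)) * (\<integral>\<^sup>+x. ennreal (smoothing \<sigma> f x) * indicator A x \<partial>lborel)
      = (\<integral>\<^sup>+y. ennreal (\<sigma> ^ DIM('b))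
          * (\<integral>\<^sup>+x. ennreal (exp (- (norm (\<sigma> *\<^sub>R (y - x)))\<^sup>2 / 2)) * indicator A x \<partial>lborel) \<partial>p)"
    by (simp add: nn_integral_cmult)
  also have "\<dots> = (\<integral>\<^sup>+y. \<integral>\<^sup>+z. indicator A (y + (1 / \<sigma>) *\<^sub>R z) * ennreal (exp (- (norm z)\<^sup>2 / 2)) \<partial>lborel \<partial>p)"
  proof (rule nn_integral_cong)
    fix y :: 'b
    let ?g = "\<lambda>z. indicator A (y + (1 / \<sigma>) *\<^sub>R z) * ennreal (exp (- (norm z)\<^sup>2 / 2))"
    have g: "?g (- \<sigma> *\<^sub>R y + \<sigma> *\<^sub>R x)
        = ennreal (exp (- (norm (\<sigma> *\<^sub>R (y - x)))\<^sup>2 / 2)) * indicator A x" for x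
    proof -
      have "- \<sigma> *\<^sub>R y + \<sigma> *\<^sub>R x = - (\<sigma> *\<^sub>R (y - x))"
        and "y + (1 / \<sigma>) *\<^sub>R (- \<sigma> *\<^sub>R y + \<sigma> *\<^sub>R x) = x"
        using \<sigma> by (simp_all add: algebra_simps)
      then show ?thesis by (simp only: norm_minus_cancel mult.commute)
    qed
    have "?g \<in> borel_measurable borel" by measurable
    from nn_integral_lborel_affine[OF this \<sigma>, of "- \<sigma> *\<^sub>R y"]
    show "ennreal (\<sigma> ^ DIM('b))
        * (\<integral>\<^sup>+x. ennreal (exp (- (norm (\<sigma> *\<^sub>R (y - x)))\<^sup>2 / 2)) * indicator A x \<partial>lborel)
      = (\<integral>\<^sup>+z. ?g z \<partial>lborel)"
      by (simp only: g)
  qed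
  finally show ?thesis .
qed

lemma nn_integral_exp_norm_square:
  "(\<integral>\<^sup>+z. ennreal (exp (- ((norm (z::'b::euclidean_space))\<^sup>2 / 2))) \<partial>lborel) = ennreal (1 / gauss (0::'b))"
proof -
  have pos: "gauss (0::'b) > 0" by (rule gauss_pos)
  have "exp (- ((norm z)\<^sup>2 / 2)) = 1 / gauss (0::'b) * gauss z" for z :: 'b
    unfolding gauss_eq[of z] using pos by simp
  then have "(\<integral>\<^sup>+z. ennreal (exp (- ((norm (z::'b))\<^sup>2 / 2))) \<partial>lborel)
      = (\<integral>\<^sup>+z. ennreal (1 / gauss (0::'b)) * ennreal (gauss (z::'b)) \<partial>lborel)"
    using pos by (intro nn_integral_cong) (simp add: less_imp_le[OF gauss_pos] flip: ennreal_mult)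
  also have "\<dots> = ennreal (1 / gauss (0::'b))"
    by (simp add: nn_integral_cmult nn_integral_gauss)
  finally show ?thesis .
qed

lemma nn_integral_smoothing_is_char_fun:
  fixes f :: "'b::euclidean_space \<Rightarrow> real"
  assumes "is_char_fun f" and \<sigma>: "\<sigma> > 0"
  shows "ennreal (\<sigma> ^ DIM('b)) * (\<integral>\<^sup>+x. ennreal (smoothing \<sigma> f x) \<partial>lborel) = ennreal (1 / gauss (0::'b))"
proof -
  obtain p where p: "prob_space p" "sets p = sets borel" "\<And>\<xi>. char_fun p \<xi> = of_real (f \<xi>)"
    using assms by (auto simp: is_char_fun_def)
  interpret prob_space p by fact
  show ?thesis
    using nn_integral_smoothing[OF p \<sigma>, of UNIV]
    by (simp add: nn_integral_exp_norm_square emeasure_space_1)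
qed

text \<open>Nonnegativity and the mass bound survive pointwise limits of characteristic functions, the first by
  dominated convergence under the Gaussian, the second by Fatou. The limit is
  \<open>f = exp (- s \<bar>\<xi>\<bar>\<^sup>\<alpha>)\<close> in the application, and only these two properties of the stable laws enter.\<close>

lemma smoothing_limit:
  fixes f :: "'b::euclidean_space \<Rightarrow> real"
  assumes char: "\<And>n. is_char_fun (u n)" and lim: "\<And>\<xi>. (\<lambda>n. u n \<xi>) \<longlonglongrightarrow> f \<xi>" and \<sigma>: "\<sigma> > 0"
  shows "0 \<le> smoothing \<sigma> f x"
    and "ennreal (\<sigma> ^ DIM('b)) * (\<integral>\<^sup>+x. ennreal (smoothing \<sigma> f x) \<partial>lborel) \<le> ennreal (1 / gauss (0::'b))"
proof -
  interpret G: prob_space "gauss_measure :: 'b measure" by (rule prob_space_gauss_measure)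
  have [measurable]: "u n \<in> borel_measurable borel" for n
    by (rule is_char_fun_measurable[OF char])
  have [measurable]: "f \<in> borel_measurable borel"
    by (rule borel_measurable_LIMSEQ_real[OF lim]) measurable
  \<comment> \<open>Characteristic functions are bounded by 1, which is integrable under the Gaussian.\<close>
  have conv: "(\<lambda>n. smoothing \<sigma> (u n) x) \<longlonglongrightarrow> smoothing \<sigma> f x" for x
    unfolding smoothing_def
  proof (rule integral_dominated_convergence[where w="\<lambda>_. 1"])
    show "AE \<xi> in gauss_measure. (\<lambda>n. cos (\<sigma> * (x \<bullet> \<xi>)) * u n (\<sigma> *\<^sub>R \<xi>))
        \<longlonglongrightarrow> cos (\<sigma> * (x \<bullet> \<xi>)) * f (\<sigma> *\<^sub>R \<xi>)"
      by (intro AE_I2 tendsto_mult tendsto_const lim)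
    show "AE \<xi> in gauss_measure. norm (cos (\<sigma> * (x \<bullet> \<xi>)) * u n (\<sigma> *\<^sub>R \<xi>)) \<le> 1" for n
      using is_char_fun_abs_le_1[OF char]
      by (intro AE_I2) (auto simp: abs_mult intro: mult_le_one)
  qed simp_all
  show "0 \<le> smoothing \<sigma> f x"
    using conv smoothing_nonneg[OF char] by (intro LIMSEQ_le_const[OF conv]) auto
  let ?c = "ennreal (\<sigma> ^ DIM('b))"
  have "?c * (\<integral>\<^sup>+x. ennreal (smoothing \<sigma> f x) \<partial>lborel)
      = (\<integral>\<^sup>+x. liminf (\<lambda>n. ?c * ennreal (smoothing \<sigma> (u n) x)) \<partial>lborel)"
  proof -
    have "liminf (\<lambda>n. ?c * ennreal (smoothing \<sigma> (u n) x)) = ?c * ennreal (smoothing \<sigma> f x)" for x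
      by (intro lim_imp_Liminf tendsto_mult_ennreal tendsto_ennrealI conv tendsto_const)
        (auto simp: \<sigma>)
    then show ?thesis by (simp add: nn_integral_cmult)
  qed
  also have "\<dots> \<le> liminf (\<lambda>n. \<integral>\<^sup>+x. ?c * ennreal (smoothing \<sigma> (u n) x) \<partial>lborel)"
    by (rule nn_integral_liminf) measurable
  also have "\<dots> = ennreal (1 / gauss (0::'b))"
    by (simp add: nn_integral_cmult nn_integral_smoothing_is_char_fun[OF char \<sigma>] Liminf_const)
  finally show "?c * (\<integral>\<^sup>+x. ennreal (smoothing \<sigma> f x) \<partial>lborel) \<le> ennreal (1 / gauss (0::'b))" .
qed

text \<open>The half of weak convergence of the smoothed laws to \<open>p\<close>, up to the total mass \<open>1 / gauss 0\<close> of the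
  Gaussian. If \<open>y\<close> lies in the open set
  \<open>U\<close>, so does \<open>y + z / \<sigma>\<close> for large \<open>\<sigma>\<close>; Fatou does the rest.\<close>

lemma open_measure_le_liminf_smoothing:
  fixes p :: "'b::euclidean_space measure"
  assumes p: "prob_space p" and sets [simp, measurable_cong]: "sets p = sets borel"
    and char: "\<And>\<xi>. char_fun p \<xi> = of_real (f \<xi>)"
    and U: "open U"
  shows "ennreal (1 / gauss (0::'b)) * emeasure p U
     \<le> liminf (\<lambda>n. ennreal (real (Suc n) ^ DIM('b))
          * (\<integral>\<^sup>+x. ennreal (smoothing (real (Suc n)) f x) * indicator U x \<partial>lborel))"
proof -
  have [measurable]: "U \<in> sets borel" using U by simp
  let ?w = "\<lambda>z::'b. ennreal (exp (- (norm z)\<^sup>2 / 2))"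
  let ?I = "\<lambda>n y z. indicator U (y + (1 / real (Suc n)) *\<^sub>R z) * ?w z"
  have lb: "indicator U y * ?w z \<le> liminf (\<lambda>n. ?I n y z)" for y z
  proof (cases "y \<in> U")
    case True
    have "(\<lambda>n. y + (1 / real (Suc n)) *\<^sub>R z) \<longlonglongrightarrow> y + 0 *\<^sub>R z"
      by (intro tendsto_intros LIMSEQ_Suc[OF lim_1_over_n])
    with U True have "eventually (\<lambda>n. y + (1 / real (Suc n)) *\<^sub>R z \<in> U) sequentially"
      by (auto dest: topological_tendstoD)
    then have "eventually (\<lambda>n. ?w z \<le> ?I n y z) sequentially"
      by (rule eventually_mono) simp
    then show ?thesis using True by (intro Liminf_bounded) auto
  qed simp
  have "ennreal (1 / gauss (0::'b)) * emeasure p U = (\<integral>\<^sup>+y. \<integral>\<^sup>+z. indicator U y * ?w z \<partial>lborel \<partial>p)"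
    by (simp add: nn_integral_cmult nn_integral_multc nn_integral_exp_norm_square mult.commute)
  also have "\<dots> \<le> (\<integral>\<^sup>+y. \<integral>\<^sup>+z. liminf (\<lambda>n. ?I n y z) \<partial>lborel \<partial>p)"
    by (intro nn_integral_mono lb)
  also have "\<dots> \<le> (\<integral>\<^sup>+y. liminf (\<lambda>n. \<integral>\<^sup>+z. ?I n y z \<partial>lborel) \<partial>p)"
    by (intro nn_integral_mono nn_integral_liminf) measurable
  also have "\<dots> \<le> liminf (\<lambda>n. \<integral>\<^sup>+y. \<integral>\<^sup>+z. ?I n y z \<partial>lborel \<partial>p)"
    by (intro nn_integral_liminf) measurable
  also have "\<dots> = liminf (\<lambda>n. ennreal (real (Suc n) ^ DIM('b))
          * (\<integral>\<^sup>+x. ennreal (smoothing (real (Suc n)) f x) * indicator U x \<partial>lborel))"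
    by (subst nn_integral_smoothing[OF p sets char]) simp_all
  finally show ?thesis .
qed

section \<open>Mixtures of exponentials\<close>

text \<open>The general principle: a law whose characteristic function is a mixture of functions
  \<open>exp (- s r(\<xi>))\<close> is absolutely continuous if the mixing law lives on \<open>s > 0\<close>, each of these functions is
  a limit of characteristic functions, and each is integrable. Splitting the mixture at a small
  \<open>\<delta>\<close>, the part with \<open>s < \<delta>\<close> has total mass at most \<open>\<nu> {..<\<delta>}\<close>, while the part with \<open>s \<ge> \<delta>\<close> has a density
  bounded by a multiple of \<open>\<integral> exp (- \<delta> r(\<xi>)) d\<xi>\<close>. Both bounds are proved for the smoothed law, uniformly in
  \<open>\<sigma>\<close>, so they pass to \<open>p\<close>; on a null set only the first contributes, and it vanishes
  as \<open>\<delta> \<rightarrow> 0\<close>.\<close>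

theorem absolutely_continuous_exponential_mixture:
  fixes p :: "'b::euclidean_space measure" and \<nu> :: "real measure" and r :: "'b \<Rightarrow> real"
  assumes p: "prob_space p" and sets_p [simp, measurable_cong]: "sets p = sets borel"
    and \<nu>: "prob_space \<nu>" and sets_\<nu> [simp, measurable_cong]: "sets \<nu> = sets borel"
    and \<nu>_pos: "AE s in \<nu>. 0 < s"
    and char: "\<And>\<xi>. char_fun p \<xi> = of_real (\<integral>s. exp (- s * r \<xi>) \<partial>\<nu>)"
    and r_meas [measurable]: "r \<in> borel_measurable borel" and r_nonneg: "\<And>\<xi>. 0 \<le> r \<xi>"
    and approx: "\<And>s. 0 < s \<Longrightarrow>
       \<exists>u. (\<forall>n. is_char_fun (u n)) \<and> (\<forall>\<xi>. (\<lambda>n. u n \<xi>) \<longlonglongrightarrow> exp (- s * r \<xi>))"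
    and fin: "\<And>s. 0 < s \<Longrightarrow> (\<integral>\<^sup>+\<xi>. ennreal (exp (- s * r \<xi>)) \<partial>lborel) < \<infinity>"
  shows "absolutely_continuous lborel p"
proof -
  interpret p: prob_space p by fact
  interpret \<nu>: prob_space \<nu> by fact
  interpret G: prob_space "gauss_measure :: 'b measure" by (rule prob_space_gauss_measure)
  interpret \<nu>G: pair_prob_space \<nu> "gauss_measure :: 'b measure" ..
  interpret \<nu>L: pair_sigma_finite \<nu> "lborel :: 'b measure" ..
  define f where "f \<xi> = (\<integral>s. exp (- s * r \<xi>) \<partial>\<nu>)" for \<xi>
  define e where "e s \<xi> = exp (- s * r \<xi>)" for s \<xi>
  have e_meas [measurable]: "(\<lambda>(s, \<xi>). e s \<xi>) \<in> borel_measurable (borel \<Otimes>\<^sub>M borel)"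
    unfolding e_def by measurable
  define g where "g = gauss (0::'b)"
  have g_pos: "g > 0" unfolding g_def by (rule gauss_pos)
  have charf: "char_fun p \<xi> = of_real (f \<xi>)" for \<xi>
    by (simp add: f_def char)
  have nonneg: "0 \<le> smoothing \<sigma> (e s) x"
    and mass: "ennreal (\<sigma> ^ DIM('b)) * (\<integral>\<^sup>+x. ennreal (smoothing \<sigma> (e s) x) \<partial>lborel) \<le> ennreal (1 / g)"
    if "s > 0" "\<sigma> > 0" for s \<sigma> x
    using approx[OF that(1)] smoothing_limit[where f="e s" and \<sigma>=\<sigma>] that(2)
    by (auto simp: e_def[abs_def] g_def)
  have sm_meas [measurable]:
    "(\<lambda>(s, x). smoothing \<sigma> (e s) x) \<in> borel_measurable (borel \<Otimes>\<^sub>M borel)" for \<sigma>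
    unfolding smoothing_def by measurable

  \<comment> \<open>Smoothing is linear, so the smoothed law is the same mixture; Fubini applies because the integrand
    is bounded by 1 for positive \<open>s\<close>.\<close>
  have mix: "ennreal (smoothing \<sigma> f x) = (\<integral>\<^sup>+s. ennreal (smoothing \<sigma> (e s) x) \<partial>\<nu>)"
    if \<sigma>: "\<sigma> > 0" for \<sigma> x
  proof -
    have int: "integrable (\<nu> \<Otimes>\<^sub>M gauss_measure)
        (\<lambda>(s, \<xi>). cos (\<sigma> * (x \<bullet> \<xi>)) * e s (\<sigma> *\<^sub>R \<xi>))"
    proof (rule \<nu>G.P.integrable_const_bound[where B=1])
      have "AE z in \<nu> \<Otimes>\<^sub>M (gauss_measure :: 'b measure). 0 < fst z"
      proof (rule \<nu>G.AE_pair_measure)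
        show "{z \<in> space (\<nu> \<Otimes>\<^sub>M (gauss_measure :: 'b measure)). 0 < fst z}
            \<in> sets (\<nu> \<Otimes>\<^sub>M gauss_measure)"
          by measurable
      qed (use \<nu>_pos in simp)
      then show "AE z in \<nu> \<Otimes>\<^sub>M gauss_measure.
          norm (case z of (s, \<xi>) \<Rightarrow> cos (\<sigma> * (x \<bullet> \<xi>)) * e s (\<sigma> *\<^sub>R \<xi>)) \<le> 1"
      proof eventually_elim
        case (elim z)
        then have "0 \<le> fst z * r (\<sigma> *\<^sub>R snd z)" by (simp add: r_nonneg)
        then show ?case
          by (auto simp: case_prod_unfold abs_mult e_def intro!: mult_le_one)
      qed
    qed measurable
    have "smoothing \<sigma> f x = (\<integral>\<xi>. (\<integral>s. cos (\<sigma> * (x \<bullet> \<xi>)) * e s (\<sigma> *\<^sub>R \<xi>) \<partial>\<nu>) \<partial>gauss_measure)"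
      by (simp add: smoothing_def f_def e_def)
    also have "\<dots> = (\<integral>s. smoothing \<sigma> (e s) x \<partial>\<nu>)"
      unfolding smoothing_def by (rule \<nu>G.Fubini_integral[OF int])
    finally have "smoothing \<sigma> f x = (\<integral>s. smoothing \<sigma> (e s) x \<partial>\<nu>)" .
    moreover have "integrable \<nu> (\<lambda>s. smoothing \<sigma> (e s) x)"
      using \<nu>G.integrable_fst[OF int] by (simp add: smoothing_def)
    moreover have "AE s in \<nu>. 0 \<le> smoothing \<sigma> (e s) x"
      using \<nu>_pos by eventually_elim (rule nonneg[OF _ \<sigma>])
    ultimately show ?thesis
      by (simp add: nn_integral_eq_integral)
  qed

  define C where "C \<delta> = ennreal g * (\<integral>\<^sup>+\<xi>. ennreal (e \<delta> \<xi>) \<partial>lborel)" for \<delta>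
  have C_fin: "C \<delta> < \<infinity>" if "\<delta> > 0" for \<delta>
    using fin[OF that] by (simp add: C_def e_def ennreal_mult_less_top)
  \<comment> \<open>The components with \<open>s \<ge> \<delta>\<close> have bounded densities: the Gaussian density is at most its value at 0,
    and rescaling \<open>\<xi>\<close> cancels \<open>\<sigma> ^ d\<close>.\<close>
  have pointwise: "ennreal (\<sigma> ^ DIM('b)) * ennreal (smoothing \<sigma> (e s) x) \<le> C \<delta>"
    if \<sigma>: "\<sigma> > 0" and \<delta>: "0 < \<delta>" "\<delta> \<le> s" for \<sigma> s \<delta> x
  proof -
    have le: "cos (\<sigma> * (x \<bullet> \<xi>)) * e s (\<sigma> *\<^sub>R \<xi>) \<le> e \<delta> (\<sigma> *\<^sub>R \<xi>)" for \<xi>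
    proof -
      have "cos (\<sigma> * (x \<bullet> \<xi>)) * e s (\<sigma> *\<^sub>R \<xi>) \<le> 1 * e s (\<sigma> *\<^sub>R \<xi>)"
        by (intro mult_right_mono) (simp_all add: e_def)
      also have "\<dots> \<le> e \<delta> (\<sigma> *\<^sub>R \<xi>)"
        using \<delta> by (simp add: e_def mult_right_mono r_nonneg)
      finally show ?thesis .
    qed
    have bnd: "e s \<xi> \<le> 1" if "s > 0" for s \<xi>
      using that r_nonneg[of \<xi>] by (simp add: e_def)
    have s: "s > 0" using \<delta> by simp
    have "smoothing \<sigma> (e s) x \<le> (\<integral>\<xi>. e \<delta> (\<sigma> *\<^sub>R \<xi>) \<partial>gauss_measure)"
      unfolding smoothing_def
    proof (rule integral_mono[OF _ _ le])
      show "integrable gauss_measure (\<lambda>\<xi>. cos (\<sigma> * (x \<bullet> \<xi>)) * e s (\<sigma> *\<^sub>R \<xi>))"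
        using bnd[OF s] by (intro G.integrable_const_bound[where B=1])
          (auto simp: abs_mult e_def intro!: mult_le_one)
      show "integrable gauss_measure (\<lambda>\<xi>. e \<delta> (\<sigma> *\<^sub>R \<xi>))"
        using bnd[OF \<delta>(1)] by (intro G.integrable_const_bound[where B=1]) (auto simp: e_def)
    qed
    then have "ennreal (smoothing \<sigma> (e s) x) \<le> ennreal (\<integral>\<xi>. e \<delta> (\<sigma> *\<^sub>R \<xi>) \<partial>gauss_measure)"
      by (rule ennreal_leI)
    also have "\<dots> = (\<integral>\<^sup>+\<xi>. ennreal (e \<delta> (\<sigma> *\<^sub>R \<xi>)) \<partial>gauss_measure)"
      using bnd[OF \<delta>(1)]
      by (intro nn_integral_eq_integral[symmetric] G.integrable_const_bound[where B=1]) (auto simp: e_def)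
    also have "\<dots> = (\<integral>\<^sup>+\<xi>. ennreal (gauss \<xi>) * ennreal (e \<delta> (\<sigma> *\<^sub>R \<xi>)) \<partial>lborel)"
      unfolding gauss_measure_def by (subst nn_integral_density) simp_all
    also have "\<dots> \<le> (\<integral>\<^sup>+\<xi>. ennreal g * ennreal (e \<delta> (\<sigma> *\<^sub>R \<xi>)) \<partial>lborel)"
      unfolding g_def by (intro nn_integral_mono mult_right_mono ennreal_leI gauss_le) simp
    also have "\<dots> = ennreal g * (\<integral>\<^sup>+\<xi>. ennreal (e \<delta> (\<sigma> *\<^sub>R \<xi>)) \<partial>lborel)"
      by (simp add: nn_integral_cmult)
    finally have "ennreal (\<sigma> ^ DIM('b)) * ennreal (smoothing \<sigma> (e s) x)
        \<le> ennreal (\<sigma> ^ DIM('b)) * (ennreal g * (\<integral>\<^sup>+\<xi>. ennreal (e \<delta> (\<sigma> *\<^sub>R \<xi>)) \<partial>lborel))"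
      by (rule mult_left_mono) simp
    also have "\<dots> = C \<delta>"
      using nn_integral_lborel_affine[OF _ \<sigma>, of "\<lambda>\<xi>. ennreal (e \<delta> \<xi>)" 0]
      by (simp add: C_def mult.left_commute)
    finally show ?thesis .
  qed

  \<comment> \<open>Components with \<open>s < \<delta>\<close> are estimated by their mass, the others by their density.\<close>
  have smoothed_bound: "ennreal (\<sigma> ^ DIM('b)) * (\<integral>\<^sup>+x. ennreal (smoothing \<sigma> f x) * indicator A x \<partial>lborel)
      \<le> ennreal (1 / g) * emeasure \<nu> {..<\<delta>} + C \<delta> * emeasure lborel A"
    if \<sigma>: "\<sigma> > 0" and \<delta>: "\<delta> > 0" and A [measurable]: "A \<in> sets borel" for \<sigma> \<delta> A
  proof -
    let ?c = "ennreal (\<sigma> ^ DIM('b))"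
    have "?c * (\<integral>\<^sup>+x. ennreal (smoothing \<sigma> f x) * indicator A x \<partial>lborel)
        = ?c * (\<integral>\<^sup>+x. \<integral>\<^sup>+s. ennreal (smoothing \<sigma> (e s) x) * indicator A x \<partial>\<nu> \<partial>lborel)"
      by (simp add: mix[OF \<sigma>] nn_integral_multc)
    also have "\<dots> = ?c * (\<integral>\<^sup>+s. \<integral>\<^sup>+x. ennreal (smoothing \<sigma> (e s) x) * indicator A x \<partial>lborel \<partial>\<nu>)"
      by (subst \<nu>L.Fubini') simp_all
    also have "\<dots> = (\<integral>\<^sup>+s. ?c * (\<integral>\<^sup>+x. ennreal (smoothing \<sigma> (e s) x) * indicator A x \<partial>lborel) \<partial>\<nu>)"
      by (simp add: nn_integral_cmult)
    also have "\<dots> \<le> (\<integral>\<^sup>+s. ennreal (1 / g) * indicator {..<\<delta>} s + C \<delta> * emeasure lborel A \<partial>\<nu>)"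
    proof (rule nn_integral_mono_AE)
      show "AE s in \<nu>. ?c * (\<integral>\<^sup>+x. ennreal (smoothing \<sigma> (e s) x) * indicator A x \<partial>lborel)
          \<le> ennreal (1 / g) * indicator {..<\<delta>} s + C \<delta> * emeasure lborel A"
        using \<nu>_pos
      proof eventually_elim
        case (elim s)
        show ?case
        proof (cases "s < \<delta>")
          case True
          have "?c * (\<integral>\<^sup>+x. ennreal (smoothing \<sigma> (e s) x) * indicator A x \<partial>lborel)
              \<le> ?c * (\<integral>\<^sup>+x. ennreal (smoothing \<sigma> (e s) x) \<partial>lborel)"
            by (intro mult_left_mono nn_integral_mono) (auto split: split_indicator)
          also have "\<dots> \<le> ennreal (1 / g)" by (rule mass[OF elim \<sigma>])
          finally show ?thesis using True by (simp add: add_increasing2)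
        next
          case False
          have "?c * (\<integral>\<^sup>+x. ennreal (smoothing \<sigma> (e s) x) * indicator A x \<partial>lborel)
              = (\<integral>\<^sup>+x. (?c * ennreal (smoothing \<sigma> (e s) x)) * indicator A x \<partial>lborel)"
            by (simp add: nn_integral_cmult mult.assoc)
          also have "\<dots> \<le> (\<integral>\<^sup>+x. C \<delta> * indicator A x \<partial>lborel)"
            using False by (intro nn_integral_mono mult_right_mono pointwise[OF \<sigma> \<delta>]) auto
          also have "\<dots> = C \<delta> * emeasure lborel A"
            by (simp add: nn_integral_cmult)
          finally show ?thesis by (simp add: add_increasing)
        qed
      qed
    qed
    also have "\<dots> = ennreal (1 / g) * emeasure \<nu> {..<\<delta>} + C \<delta> * emeasure lborel A"
      by (simp add: nn_integral_add nn_integral_cmult \<nu>.emeasure_space_1)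
    finally show ?thesis .
  qed

  have open_bound: "ennreal (1 / g) * emeasure p U
      \<le> ennreal (1 / g) * emeasure \<nu> {..<\<delta>} + C \<delta> * emeasure lborel U"
    if U: "open U" and \<delta>: "\<delta> > 0" for U \<delta>
  proof -
    have "ennreal (1 / g) * emeasure p U
        \<le> liminf (\<lambda>n. ennreal (real (Suc n) ^ DIM('b))
            * (\<integral>\<^sup>+x. ennreal (smoothing (real (Suc n)) f x) * indicator U x \<partial>lborel))"
      unfolding g_def by (rule open_measure_le_liminf_smoothing[OF p sets_p charf U])
    also have "\<dots> \<le> liminf (\<lambda>n::nat. ennreal (1 / g) * emeasure \<nu> {..<\<delta>} + C \<delta> * emeasure lborel U)"
      using U by (intro Liminf_mono always_eventually allI smoothed_bound[OF _ \<delta>]) simp_all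
    finally show ?thesis by (simp add: Liminf_const)
  qed

  have "emeasure p N = 0" if N: "N \<in> null_sets lborel" for N
  proof -
    have N_sets [measurable]: "N \<in> sets borel" and N0: "emeasure lborel N = 0"
      using N by auto
    have small: "emeasure p N \<le> emeasure \<nu> {..<\<delta>}" if \<delta>: "\<delta> > 0" for \<delta>
    proof -
      have "ennreal (1 / g) * emeasure p N \<le> ennreal (1 / g) * emeasure \<nu> {..<\<delta>}"
      proof (rule ennreal_le_epsilon)
        fix \<epsilon> :: real assume \<epsilon>: "\<epsilon> > 0"
        obtain c where c: "C \<delta> = ennreal c" "c \<ge> 0"
          using C_fin[OF \<delta>] by (cases "C \<delta>") auto
        \<comment> \<open>A bound on the measure of \<open>U\<close> that keeps \<open>C \<delta> * emeasure lborel U\<close> below \<open>\<epsilon>\<close>, even when \<open>c = 0\<close>.\<close>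
        define \<eta> where "\<eta> = \<epsilon> / (c + 1)"
        have \<eta>: "\<eta> > 0" using \<epsilon> c by (simp add: \<eta>_def)
        obtain U where U: "open U" "N \<subseteq> U" and diff: "emeasure lborel (U - N) < ennreal \<eta>"
          using outer_regular_lborel[OF N_sets \<eta>] by auto
        have "emeasure lborel U = emeasure lborel (U - N)"
          using emeasure_Diff_null_set[OF N, of U] U by simp
        with diff have "C \<delta> * emeasure lborel U \<le> ennreal c * ennreal \<eta>"
          unfolding c by (intro mult_left_mono) auto
        also have "\<dots> \<le> ennreal \<epsilon>"
          using c \<epsilon> by (simp add: \<eta>_def field_simps flip: ennreal_mult)
        finally have *: "C \<delta> * emeasure lborel U \<le> ennreal \<epsilon>" .
        have "ennreal (1 / g) * emeasure p N \<le> ennreal (1 / g) * emeasure p U"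
          using U by (intro mult_left_mono emeasure_mono) auto
        also have "\<dots> \<le> ennreal (1 / g) * emeasure \<nu> {..<\<delta>} + C \<delta> * emeasure lborel U"
          by (rule open_bound[OF U(1) \<delta>])
        also have "\<dots> \<le> ennreal (1 / g) * emeasure \<nu> {..<\<delta>} + ennreal \<epsilon>"
          by (intro add_left_mono *)
        finally show "ennreal (1 / g) * emeasure p N
            \<le> ennreal (1 / g) * emeasure \<nu> {..<\<delta>} + ennreal \<epsilon>" .
      qed
      then show ?thesis
        using g_pos by (simp add: ennreal_mult_le_mult_iff)
    qed
    have "(\<lambda>n. measure \<nu> {..<1 / real (Suc n)}) \<longlonglongrightarrow> measure \<nu> (\<Inter>n. {..<1 / real (Suc n)})"
      by (intro \<nu>.finite_Lim_measure_decseq)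
        (auto simp: decseq_def intro: order.strict_trans2 frac_le)
    moreover have "measure \<nu> (\<Inter>n. {..<1 / real (Suc n)}) = 0"
    proof -
      have "(\<Inter>n. {..<1 / real (Suc n)}) \<subseteq> {..0}"
      proof
        fix x :: real assume x: "x \<in> (\<Inter>n. {..<1 / real (Suc n)})"
        have "x \<le> 1 / real (Suc n)" for n using x by (auto intro: less_imp_le)
        moreover have "(\<lambda>n. 1 / real (Suc n)) \<longlonglongrightarrow> 0" by (rule LIMSEQ_Suc[OF lim_1_over_n])
        ultimately show "x \<in> {..0}" by (auto intro: LIMSEQ_le_const)
      qed
      then have "AE s in \<nu>. s \<notin> (\<Inter>n. {..<1 / real (Suc n)})"
        using \<nu>_pos by (elim eventually_mono) (meson atMost_iff linorder_not_le subsetD)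
      then show ?thesis by (subst \<nu>.prob_eq_0) simp_all
    qed
    ultimately have "(\<lambda>n. measure \<nu> {..<1 / real (Suc n)}) \<longlonglongrightarrow> 0" by simp
    moreover have "measure p N \<le> measure \<nu> {..<1 / real (Suc n)}" for n
      using small[of "1 / real (Suc n)"]
      by (simp add: p.emeasure_eq_measure \<nu>.emeasure_eq_measure)
    ultimately have "measure p N \<le> 0"
      by (intro LIMSEQ_le_const) auto
    then show ?thesis
      using measure_nonneg[of p N] by (simp add: p.emeasure_eq_measure)
  qed
  then show ?thesis
    by (auto simp: absolutely_continuous_def null_sets_def)
qed

section \<open>Integrability of stretched exponentials\<close>

lemma nn_integral_exp_neg_abs_powr_finite:
  fixes c a :: real
  assumes "c > 0" "a > 0"
  shows "(\<integral>\<^sup>+x. ennreal (exp (- c * \<bar>x\<bar> powr a)) \<partial>lborel) < \<infinity>"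
proof -
  have lim: "((\<lambda>x. exp (- c * x powr a) * (1 + x\<^sup>2)) \<longlongrightarrow> 0) at_top"
    using assms by real_asymp
  then have "eventually (\<lambda>x. exp (- c * x powr a) * (1 + x\<^sup>2) < 1) at_top"
    by (rule order_tendstoD) simp
  then obtain R where R: "\<And>x. x \<ge> R \<Longrightarrow> exp (- c * x powr a) * (1 + x\<^sup>2) < 1"
    by (auto simp: eventually_at_top_linorder)
  define K where "K = 1 + R\<^sup>2"
  have bound: "exp (- c * \<bar>x\<bar> powr a) \<le> K * inverse (1 + x\<^sup>2)" for x
  proof (cases "\<bar>x\<bar> \<ge> R")
    case True
    have "exp (- c * \<bar>x\<bar> powr a) * (1 + x\<^sup>2) \<le> K"
      using R[OF True] by (simp add: K_def add_increasing2)
    then show ?thesis by (simp add: field_simps add_pos_nonneg)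
  next
    case False
    then have "x\<^sup>2 \<le> R\<^sup>2" by (intro abs_le_square_iff[THEN iffD1]) auto
    moreover have "exp (- c * \<bar>x\<bar> powr a) \<le> 1" using assms by simp
    ultimately have "exp (- c * \<bar>x\<bar> powr a) * (1 + x\<^sup>2) \<le> 1 * K"
      by (intro mult_mono) (auto simp: K_def)
    then show ?thesis by (simp add: field_simps add_pos_nonneg)
  qed
  have "integrable lborel (\<lambda>x::real. inverse (1 + x\<^sup>2))"
    using Sinc_Integral.integrable_inverse_1_plus_square
    by (simp add: set_integrable_def einterval_def)
  then have "integrable lborel (\<lambda>x::real. K * inverse (1 + x\<^sup>2))" by simp
  then have "integrable lborel (\<lambda>x::real. exp (- c * \<bar>x\<bar> powr a))"
    by (rule Bochner_Integration.integrable_bound)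
      (use bound in \<open>auto intro: order.trans[OF _ abs_ge_self]\<close>)
  then show ?thesis by (simp add: integrable_iff_bounded)
qed

text \<open>The Euclidean norm dominates every coordinate, hence \<open>norm x powr a\<close> dominates the average of the
  \<open>\<bar>x \<bullet> b\<bar> powr a\<close>, and the integral is at most a product of one-dimensional ones.\<close>

lemma nn_integral_exp_neg_norm_powr_finite:
  fixes c a :: real
  assumes c: "c > 0" and a: "a > 0"
  shows "(\<integral>\<^sup>+x. ennreal (exp (- c * norm (x::'b::euclidean_space) powr a)) \<partial>lborel) < \<infinity>"
proof -
  let ?d = "real DIM('b)"
  have "exp (- c * norm x powr a) \<le> (\<Prod>b\<in>Basis. exp (- (c / ?d) * \<bar>x \<bullet> b\<bar> powr a))" for x :: 'b
  proof -
    have "(\<Sum>b\<in>Basis. \<bar>x \<bullet> b\<bar> powr a) \<le> (\<Sum>b\<in>(Basis::'b set). norm x powr a)"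
      using a by (intro sum_mono powr_mono2) (auto simp: Basis_le_norm)
    also have "\<dots> = ?d * norm x powr a" by simp
    finally have "(c / ?d) * (\<Sum>b\<in>Basis. \<bar>x \<bullet> b\<bar> powr a) \<le> (c / ?d) * (?d * norm x powr a)"
      using c by (intro mult_left_mono) auto
    then have "exp (- c * norm x powr a) \<le> exp (\<Sum>b\<in>Basis. - (c / ?d) * \<bar>x \<bullet> b\<bar> powr a)"
      by (simp add: sum_negf sum_distrib_left)
    then show ?thesis by (simp only: exp_sum[OF finite_Basis])
  qed
  then have "(\<integral>\<^sup>+x. ennreal (exp (- c * norm (x::'b) powr a)) \<partial>lborel)
      \<le> (\<integral>\<^sup>+x. (\<Prod>b\<in>Basis. ennreal (exp (- (c / ?d) * \<bar>(x::'b) \<bullet> b\<bar> powr a))) \<partial>lborel)"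
    by (intro nn_integral_mono) (simp add: prod_ennreal ennreal_leI)
  also have "\<dots> = (\<Prod>b\<in>(Basis::'b set). \<integral>\<^sup>+x. ennreal (exp (- (c / ?d) * \<bar>x\<bar> powr a)) \<partial>lborel)"
    by (rule nn_integral_lborel_prod) simp_all
  also have "\<dots> < \<infinity>"
    using nn_integral_exp_neg_abs_powr_finite[OF _ a, of "c / ?d"] c
    by (simp add: power_less_top_ennreal)
  finally show ?thesis .
qed

section \<open>The Gamma law\<close>

definition gamma_measure :: "real \<Rightarrow> real measure" where
  "gamma_measure t =
     density lborel (\<lambda>s. ennreal (indicator {0..} s * s powr (t - 1) / exp s / Gamma t))"

text \<open>The Laplace transform of the Gamma law, by the substitution \<open>s \<mapsto> (1 + c) s\<close> in Euler's integral.\<close>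

lemma nn_integral_gamma_measure:
  assumes t: "t > 0" and c: "c \<ge> 0"
  shows "(\<integral>\<^sup>+s. ennreal (exp (- s * c)) \<partial>gamma_measure t) = ennreal ((1 + c) powr (- t))"
proof -
  have G: "Gamma t > 0" using t by (rule Gamma_real_pos)
  let ?h = "\<lambda>s::real. ennreal (indicator {0..} s * s powr (t - 1) / exp s)"
  let ?k = "(1 + c) powr (- t) / Gamma t"
  have "(\<integral>\<^sup>+s. ennreal (exp (- s * c)) \<partial>gamma_measure t)
      = (\<integral>\<^sup>+s. ennreal ((1 + c) powr (1 - t) / Gamma t) * ?h (0 + (1 + c) * s) \<partial>lborel)"
  proof -
    have "(\<integral>\<^sup>+s. ennreal (exp (- s * c)) \<partial>gamma_measure t)
        = (\<integral>\<^sup>+s. ennreal (indicator {0..} s * s powr (t - 1) / exp s / Gamma t)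
             * ennreal (exp (- s * c)) \<partial>lborel)"
      unfolding gamma_measure_def by (subst nn_integral_density) simp_all
    also have "\<dots> = (\<integral>\<^sup>+s. ennreal ((1 + c) powr (1 - t) / Gamma t) * ?h (0 + (1 + c) * s) \<partial>lborel)"
    proof (rule nn_integral_cong)
      fix s :: real
      show "ennreal (indicator {0..} s * s powr (t - 1) / exp s / Gamma t) * ennreal (exp (- s * c))
          = ennreal ((1 + c) powr (1 - t) / Gamma t) * ?h (0 + (1 + c) * s)"
      proof (cases "s \<ge> 0")
        case True
        have "(1 + c) powr (1 - t) * (1 + c) powr (t - 1) = 1"
          using c by (simp flip: powr_add)
        then have "(1 + c) powr (1 - t) * ((1 + c) * s) powr (t - 1) = s powr (t - 1)"
          using True c by (simp add: powr_mult mult.assoc[symmetric])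
        moreover have "exp ((1 + c) * s) = exp s / exp (- s * c)"
          by (simp add: algebra_simps flip: exp_diff)
        ultimately have "s powr (t - 1) / exp s / Gamma t * exp (- s * c)
            = (1 + c) powr (1 - t) / Gamma t * (((1 + c) * s) powr (t - 1) / exp ((1 + c) * s))"
          using G by (simp add: field_simps)
        then show ?thesis
          using True c G by (simp flip: ennreal_mult)
      next
        case False
        moreover have "\<not> 0 \<le> (1 + c) * s"
          using False c by (simp add: zero_le_mult_iff)
        ultimately show ?thesis by simp
      qed
    qed
    finally show ?thesis .
  qed
  also have "\<dots> = ennreal ?k * (ennreal (1 + c) * (\<integral>\<^sup>+s. ?h (0 + (1 + c) * s) \<partial>lborel))"
  proof -
    have "(1 + c) powr (1 - t) / Gamma t = ?k * (1 + c)"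
      using c by (simp add: powr_diff powr_minus field_simps)
    then have "ennreal ((1 + c) powr (1 - t) / Gamma t) = ennreal ?k * ennreal (1 + c)"
      using c G by (metis add_nonneg_nonneg divide_nonneg_pos ennreal_mult powr_ge_zero zero_le_one)
    then show ?thesis
      by (subst nn_integral_cmult) (simp_all only: mult.assoc, measurable)
  qed
  also have "ennreal (1 + c) * (\<integral>\<^sup>+s. ?h (0 + (1 + c) * s) \<partial>lborel) = (\<integral>\<^sup>+s. ?h s \<partial>lborel)"
    using c nn_integral_real_affine[of ?h "1 + c" 0] by simp
  also have "\<dots> = ennreal (Gamma t)"
    using Gamma_conv_nn_integral_real[OF t] by simp
  also have "ennreal ?k * ennreal (Gamma t) = ennreal ((1 + c) powr (- t))"
    using G by (simp flip: ennreal_mult)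
  finally show ?thesis .
qed

lemma sets_gamma_measure [simp, measurable_cong]: "sets (gamma_measure t) = sets borel"
  by (simp add: gamma_measure_def)

lemma prob_space_gamma_measure: "t > 0 \<Longrightarrow> prob_space (gamma_measure t)"
  using nn_integral_gamma_measure[of t 0] by (intro prob_spaceI) simp

lemma AE_gamma_measure_pos: "AE s in gamma_measure t. 0 < s"
proof -
  have "AE s in lborel. s \<noteq> (0::real)" by (rule AE_lborel_singleton)
  then show ?thesis
    unfolding gamma_measure_def
    by (subst AE_density) (auto elim!: eventually_mono split: split_indicator_asm)
qed

lemma integral_gamma_measure:
  assumes t: "t > 0" and c: "c \<ge> 0"
  shows "(\<integral>s. exp (- s * c) \<partial>gamma_measure t) = (1 + c) powr (- t)"
  using nn_integral_gamma_measure[OF assms]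
  by (intro integral_eq_nn_integral[THEN trans]) simp_all

section \<open>Geometric stable laws and processes\<close>

text \<open>Euler's limit \<open>(1 + c / y) powr (- y) \<rightarrow> exp (- c)\<close> along \<open>y = t (n + 1)\<close>, with \<open>c = s \<bar>\<xi>\<bar>\<^sup>\<alpha>\<close>: the approximants
  are characteristic functions of sums of \<open>n + 1\<close> independent copies of the given law, rescaled so that
  \<open>\<bar>\<xi>\<bar>\<^sup>\<alpha>\<close> gets the factor \<open>s / y\<close>. The given law thus supplies its own stable
  approximations.\<close>

lemma exp_neg_norm_powr_limit_of_char_funs:
  fixes \<alpha> t s :: real
  assumes \<alpha>: "\<alpha> > 0" and t: "t > 0" and s: "s > 0"
    and char: "is_char_fun (\<lambda>\<xi>::'b::euclidean_space. (1 + norm \<xi> powr \<alpha>) powr (- t))"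
  shows "\<exists>u. (\<forall>n. is_char_fun (u n)) \<and> (\<forall>\<xi>::'b. (\<lambda>n. u n \<xi>) \<longlonglongrightarrow> exp (- s * norm \<xi> powr \<alpha>))"
proof -
  define y where "y n = t * real (Suc n)" for n
  define c where "c n = (s / y n) powr (1 / \<alpha>)" for n
  let ?f = "\<lambda>\<xi>::'b. (1 + norm \<xi> powr \<alpha>) powr (- t)"
  let ?u = "\<lambda>n \<xi>. ?f (c n *\<^sub>R \<xi>) ^ Suc n"
  have y_pos: "y n > 0" for n using t by (simp add: y_def)
  have "is_char_fun (?u n)" for n
    by (intro is_char_fun_power is_char_fun_scale char)
  moreover have "(\<lambda>n. ?u n \<xi>) \<longlonglongrightarrow> exp (- s * norm \<xi> powr \<alpha>)" for \<xi>
  proof -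
    let ?x = "s * norm \<xi> powr \<alpha>"
    have u_eq: "?u n \<xi> = inverse ((1 + ?x / y n) powr y n)" for n
    proof -
      have "norm (c n *\<^sub>R \<xi>) powr \<alpha> = ?x / y n"
        using \<alpha> s y_pos[of n] by (simp add: c_def powr_mult powr_powr)
      moreover have "0 < 1 + ?x / y n"
        using s y_pos[of n] by (intro add_pos_nonneg) auto
      ultimately show ?thesis
        by (simp only: powr_power powr_minus[symmetric]) (simp add: y_def mult.commute)
    qed
    have "filterlim y at_top sequentially"
      unfolding y_def using t
      by (intro filterlim_tendsto_pos_mult_at_top[OF tendsto_const t]
          filterlim_compose[OF filterlim_real_sequentially filterlim_Suc])
    then have "(\<lambda>n. (1 + ?x / y n) powr y n) \<longlonglongrightarrow> exp ?x"
      by (rule filterlim_compose[OF tendsto_exp_limit_at_top])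
    then have "(\<lambda>n. inverse ((1 + ?x / y n) powr y n)) \<longlonglongrightarrow> inverse (exp ?x)"
      by (rule tendsto_inverse) simp
    then show ?thesis by (simp only: u_eq exp_minus[symmetric] minus_mult_left)
  qed
  ultimately show ?thesis by (intro exI[of _ ?u]) blast
qed

theorem geometric_stable_law_absolutely_continuous:
  fixes p :: "'b::euclidean_space measure"
  assumes \<alpha>: "0 < \<alpha>" and t: "0 < t"
    and p: "prob_space p" "sets p = sets borel"
    and char: "\<And>\<xi>. char_fun p \<xi> = of_real ((1 + norm \<xi> powr \<alpha>) powr (- t))"
  shows "absolutely_continuous lborel p"
proof (rule absolutely_continuous_exponential_mixture
    [where \<nu>="gamma_measure t" and r="\<lambda>\<xi>. norm \<xi> powr \<alpha>"])
  show "char_fun p \<xi> = of_real (\<integral>s. exp (- s * norm \<xi> powr \<alpha>) \<partial>gamma_measure t)" for \<xi>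
    using integral_gamma_measure[OF t, of "norm \<xi> powr \<alpha>"] by (simp add: char)
  have "is_char_fun (\<lambda>\<xi>::'b. (1 + norm \<xi> powr \<alpha>) powr (- t))"
    using p char by (auto simp: is_char_fun_def)
  then show "\<exists>u. (\<forall>n. is_char_fun (u n)) \<and> (\<forall>\<xi>::'b. (\<lambda>n. u n \<xi>) \<longlonglongrightarrow> exp (- s * norm \<xi> powr \<alpha>))"
    if "0 < s" for s
    by (rule exp_neg_norm_powr_limit_of_char_funs[OF \<alpha> t that])
  show "(\<integral>\<^sup>+\<xi>. ennreal (exp (- s * norm (\<xi>::'b) powr \<alpha>)) \<partial>lborel) < \<infinity>" if "0 < s" for s
    by (rule nn_integral_exp_neg_norm_powr_finite[OF that \<alpha>])
qed (simp_all add: p prob_space_gamma_measure[OF t] AE_gamma_measure_pos)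

text \<open>Translating a Radon-Nikodym density \<open>f\<^sub>t\<close> of the law at time \<open>t\<close> gives \<open>\<rho>\<^sub>t(x, y) = f\<^sub>t(y - x)\<close>, which is
  jointly measurable.\<close>

lemma has_transition_density_if_absolutely_continuous:
  fixes L :: "real \<Rightarrow> 'w \<Rightarrow> 'b::euclidean_space"
  assumes meas: "\<And>t. t > 0 \<Longrightarrow> L t \<in> borel_measurable M"
    and ac: "\<And>t. t > 0 \<Longrightarrow> absolutely_continuous lborel (transition_measure M L t)"
  shows "has_transition_density M L"
proof -
  have "\<exists>f. f \<in> borel_measurable borel \<and> density lborel f = transition_measure M L t" if "t > 0" for t
    using sigma_finite_measure.Radon_Nikodym[OF sigma_finite_lborel ac[OF that]]
    by (auto simp: transition_measure_def)
  then obtain f where f [measurable]: "\<And>t. t > 0 \<Longrightarrow> f t \<in> borel_measurable borel"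
    and dens: "\<And>t. t > 0 \<Longrightarrow> density lborel (f t) = transition_measure M L t"
    by metis
  have "transition_kernel M L t x = density lborel (\<lambda>y. f t (y - x))" if t: "t > 0" for t x
  proof -
    note [measurable] = meas[OF t] f[OF t]
    have "transition_kernel M L t x = distr (transition_measure M L t) borel (\<lambda>y. x + y)"
      unfolding transition_kernel_def transition_measure_def
      by (simp add: distr_distr comp_def)
    also have "\<dots> = distr (density lborel (\<lambda>y. f t (x + y - x))) borel (\<lambda>y. x + y)"
      by (simp add: dens[OF t])
    also have "\<dots> = density (distr lborel borel (\<lambda>y. x + y)) (\<lambda>y. f t (y - x))"
      by (rule density_distr[symmetric]) measurable
    also have "\<dots> = density lborel (\<lambda>y. f t (y - x))"
      by (simp add: lborel_distr_plus)
    finally show ?thesis .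
  qed
  moreover have "(\<lambda>(x, y). f t (y - x)) \<in> borel_measurable (borel \<Otimes>\<^sub>M borel)" if "t > 0" for t
    using f[OF that] by measurable
  ultimately show ?thesis
    unfolding has_transition_density_def
    by (intro exI[of _ "\<lambda>t x y. f t (y - x)"]) simp
qed

theorem theorem3p4:
  fixes \<alpha> :: real
  assumes "0 < \<alpha>" and "\<alpha> \<le> 2"
  shows "(\<forall>(M :: 'w measure) (L :: real \<Rightarrow> 'w \<Rightarrow> real ^ 'n).
            geometric_stable_process \<alpha> M L \<longrightarrow>
              has_transition_density M L \<and>
              (\<forall>t>0. absolutely_continuous lborel (transition_measure M L t)))
       \<and> (\<forall>t>0. \<forall>p :: (real ^ 'n) measure.
            prob_space p \<and> sets p = sets borel \<and>
            (\<forall>\<xi>. char_fun p \<xi> = of_real ((1 + norm \<xi> powr \<alpha>) powr (- t))) \<longrightarrow>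
              absolutely_continuous lborel p)"
proof (intro conjI allI impI)
  fix t :: real and p :: "(real ^ 'n) measure"
  assume "0 < t" and "prob_space p \<and> sets p = sets borel \<and>
      (\<forall>\<xi>. char_fun p \<xi> = of_real ((1 + norm \<xi> powr \<alpha>) powr (- t)))"
  then show "absolutely_continuous lborel p"
    by (intro geometric_stable_law_absolutely_continuous[OF assms(1)]) auto
next
  fix M :: "'w measure" and L :: "real \<Rightarrow> 'w \<Rightarrow> real ^ 'n"
  assume "geometric_stable_process \<alpha> M L"
  then have M: "prob_space M" and L: "\<And>t. t \<ge> 0 \<Longrightarrow> L t \<in> borel_measurable M"
    and symbol: "\<And>t \<xi>. t \<ge> 0 \<Longrightarrow>
      char_fun (transition_measure M L t) \<xi> = of_real (exp (- t * ln (1 + norm \<xi> powr \<alpha>)))"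
    by (auto simp: geometric_stable_process_def levy_process_def has_symbol_def)
  show ac: "absolutely_continuous lborel (transition_measure M L t)" if t: "0 < t" for t
  proof (rule geometric_stable_law_absolutely_continuous[OF assms(1) t])
    show "prob_space (transition_measure M L t)"
      unfolding transition_measure_def using t by (intro prob_space.prob_space_distr M L) simp
    show "char_fun (transition_measure M L t) \<xi> = of_real ((1 + norm \<xi> powr \<alpha>) powr (- t))" for \<xi>
    proof -
      have "1 + norm \<xi> powr \<alpha> \<noteq> 0" by (smt (verit) powr_ge_zero)
      then show ?thesis using t by (simp add: symbol powr_def)
    qed
  qed (simp add: transition_measure_def)
  show "has_transition_density M L"
    by (rule has_transition_density_if_absolutely_continuous[OF L ac]) simp_all
qed

end
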